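(* The restriction to $\mathbb{Z}_p\subset H$ of the scaling action $\theta$ on the dual system $\hat{\mathcal{A}}_H(\mathcal{L}_{\mathbb{K},1})$ corresponds, under the map $f\mapsto X_f$, to the scaling action on $\mathbb{K}$-lattices of the subgroup $U_1=\{\gamma\in\mathbb{K}_{\infty,+}^*:\ \Theta(\gamma)\in\mathrm{Gal}(\mathbb{K}_\infty^{ab}/\mathbb{K}_\infty^{un})\}$ of $\mathbb{K}_{\infty,+}^*$ that maps to the inertia group under the local class field homomorphism $\Theta$: the restricted action of $\lambda$ depends only on $\gamma=\langle\lambda\rangle\in U_1$ and corresponds to $L\mapsto\gamma L$. The restriction of $\theta$ to the subgroup $\{s=(x,0):x\in G\}\subset H\subset S_\infty$ corresponds in the same way to the group of integer powers of the Frobenius: the restricted action of $\lambda$ depends only on $m=v_\infty(\lambda)\in\mathbb{Z}$ and corresponds to $L\mapsto u_\infty^mL$, where $\Theta(u_\infty^m)$ is the $m$-th power of the (lifted) Frobenius.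
   Context: $\mathbb{K}$ is the function field of a smooth projective geometrically connected curve over $\mathbb{F}_q$ ($q$ a power of $p$), $\infty$ a fixed place of degree $d_\infty$ with valuation $v_\infty$, $\mathbf{A}\subset\mathbb{K}$ the ring of functions regular outside $\infty$, $\mathbf{C}_\infty$ the completion of an algebraic closure of $\mathbb{K}_\infty$, $\mathbb{A}_{\mathbb{K},f}$ the finite adeles, $R=\prod_{v\ne\infty}\mathbf{A}_v$. Fix a uniformizer $u_\infty$ at $\infty$; then $\mathbb{K}_\infty^*=\mathbb{F}_{q^{d_\infty}}^*\times u_\infty^{\mathbb{Z}}\times U_1$, $U_1$ the 1-units, and $\mathbb{K}_{\infty,+}^*=u_\infty^{\mathbb{Z}}\times U_1$; write $\lambda=u_\infty^{v_\infty(\lambda)}\langle\lambda\rangle$ for $\lambda\in\mathbb{K}_{\infty,+}^*$. $S_\infty=\mathbf{C}_\infty^*\times\mathbb{Z}_p$ (group law $(x_1,y_1)+(x_2,y_2)=(x_1x_2,y_1+y_2)$) and $\lambda^s=x^{\deg\lambda}\langle\lambda\rangle^y$, $\deg\lambda=-d_\infty v_\infty(\lambda)$, for $s=(x,y)$, $w^y=\sum_j\binom{y}{j}(w-1)^j$. $\Theta:\mathbb{K}_\infty^*\to\mathrm{Gal}(\mathbb{K}_\infty^{ab}/\mathbb{K}_\infty)$ is the (injective) local Artin homomorphism; it maps the units of the ring of integers isomorphically onto the inertia group $\mathrm{Gal}(\mathbb{K}_\infty^{ab}/\mathbb{K}_\infty^{un})$ and $u_\infty$ to a lift of the Frobenius.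 Let $H=G\times\mathbb{Z}_p\subset S_\infty$ with $G$ a totally disconnected compact subgroup of $\mathbf{C}_\infty^*$, and $\mu$ a $\mathbb{K}_\infty$-valued non-archimedean measure on $H$. A 1-dimensional $\mathbb{K}$-rational lattice is $L=(\Lambda,\phi)$, $\Lambda\subset\mathbb{K}$ a fractional ideal, $\phi:\mathbb{K}/\mathbf{A}\to\mathbb{K}/\Lambda$ an $\mathbf{A}$-homomorphism; adelically $\Lambda=Rg^{-1}\cap\mathbb{K}$, $\phi=\rho g^{-1}$ with $g\in\mathbb{A}_{\mathbb{K},f}^*$, $\rho\in R$, and $L\sim L'$ if $\rho g^{-1}=\rho'g'^{-1}$. For $\lambda\in\mathbb{K}_\infty^*$, $\lambda L=(\lambda\Lambda,\lambda\phi)$ is a lattice in $\mathbb{K}_\infty$; $\tilde{\mathcal{L}}_{\mathbb{K},1}$ is the set of commensurability classes of lattices $\lambda L$. $\mathcal{A}=\mathcal{A}_{\mathbf{C}_\infty}(\mathcal{L}_{\mathbb{K},1})$ is the convolution algebra of continuous compactly supported functions $f(L,L')$, $L\sim L'$, invariant under $(L,L')\mapsto(kL,kL')$, $k\in\mathbb{K}^*$, with time evolution $(\sigma_sf)(L,L')=(\Lambda^s/\Lambda'^s)f(L,L')$ where for fractional ideals $I^s=x^{\deg I}\langle I\rangle^y$ ($\langle\cdot\rangle$ the unique extension to fractional ideals, with values in 1-units of $\mathbf{C}_\infty$, of $(a)\mapsto\langle a\rangle$, $a\in\mathbb{K}^*\cap\mathbb{K}_{\infty,+}^*$). The dual system $\hat{\mathcal{A}}_H(\mathcal{L}_{\mathbb{K},1})$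 is the algebra generated by elements $f=\int_H\ell(s)U_s\,d\mu(s)$, $\ell\in C(H,\mathcal{A})$, where $U_s$ are symbols with $U_{s+s'}=U_sU_{s'}$ and $U_s\ell(s')=\sigma_s(\ell(s'))U_s$. The scaling action of $\lambda\in\mathbb{K}_{\infty,+}^*$ is $\theta_\lambda(f)=\int_H\ell(s)\lambda^sU_s\,d\mu(s)$. Its restriction to $\mathbb{Z}_p$ is $\theta_\lambda|_{\mathbb{Z}_p}(f)=\int_H\ell(x,y)\langle\lambda\rangle^yU_{(x,y)}d\mu(x,y)$, and its restriction to $G$ is $\theta_\lambda|_G(f)=\int_H\ell(x,y)x^{\deg\lambda}U_{(x,y)}d\mu(x,y)$. The map $f\mapsto X_f$ is $X_f(\lambda L,\lambda L')=\int_H\ell(s)(L,L')\,\lambda^s\,U(s)\,d\mu(s)$, for commensurable $L,L'$ and $\lambda\in\mathbb{K}_{\infty,+}^*$, where $U(s)$, $s\in H$, are operators on a Banach space (with $U(s+s')=U(s)U(s')$) implementing the time evolution. That an action $f\mapsto\theta(f)$ corresponds under $f\mapsto X_f$ to $L\mapsto\gamma L$ means $X_{\theta(f)}(\lambda L,\lambda L')=X_f(\gamma\lambda L,\gamma\lambda L')$ for all $f=\int_H\ell(s)U_s\,d\mu(s)$, $\lambda$, and $L\sim L'$. *)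

theory Defs
  imports
    "HOL-Analysis.Analysis"
    "HOL-Computational_Algebra.Polynomial"
    "HOL-Library.Disjoint_Sets"
    "HOL-Algebra.Bij"
begin

section \<open>Subfields and Galois groups inside a fixed field\<close>

text \<open>
  All fields (the constant field, the function field, the local field at infinity and its algebraic
  extensions) are subsets of one ambient type, which plays the role of the completed algebraic
  closure \<open>C\<^sub>\<infinity>\<close>.
\<close>

definition is_subfield :: "'c::field set \<Rightarrow> bool" where
  "is_subfield E \<longleftrightarrow> 0 \<in> E \<and> 1 \<in> E \<and> (\<forall>x\<in>E. \<forall>y\<in>E. x - y \<in> E \<and> x * y \<in> E)
     \<and> (\<forall>x\<in>E. inverse x \<in> E)"

definition algebraic_over :: "'c::field set \<Rightarrow> 'c \<Rightarrow> bool" where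
  "algebraic_over F x \<longleftrightarrow> (\<exists>P. P \<noteq> 0 \<and> (\<forall>i. coeff P i \<in> F) \<and> poly P x = 0)"

definition finite_ext :: "'c::field set \<Rightarrow> 'c set \<Rightarrow> bool" where
  "finite_ext F E \<longleftrightarrow> is_subfield F \<and> is_subfield E \<and> F \<subseteq> E \<and>
     (\<exists>B. finite B \<and> B \<subseteq> E \<and> (\<forall>x\<in>E. \<exists>k. (\<forall>b\<in>B. k b \<in> F) \<and> x = (\<Sum>b\<in>B. k b * b)))"

definition gal :: "'c::field set \<Rightarrow> 'c set \<Rightarrow> ('c \<Rightarrow> 'c) monoid" where
  "gal E F = (BijGroup E) \<lparr>carrier := {\<sigma> \<in> Bij E.
     (\<forall>x\<in>E. \<forall>y\<in>E. \<sigma> (x + y) = \<sigma> x + \<sigma> y \<and> \<sigma> (x * y) = \<sigma> x * \<sigma> y) \<and> (\<forall>x\<in>F. \<sigma> x = x)}\<rparr>"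

definition abelian_ext :: "'c::field set \<Rightarrow> 'c set \<Rightarrow> bool" where
  "abelian_ext F E \<longleftrightarrow> finite_ext F E
     \<and> {x \<in> E. \<forall>\<sigma>\<in>carrier (gal E F). \<sigma> x = x} = F
     \<and> comm_group (gal E F)"

definition galois_norm :: "'c::field set \<Rightarrow> 'c set \<Rightarrow> 'c \<Rightarrow> 'c" where
  "galois_norm E F x = (\<Prod>\<sigma>\<in>carrier (gal E F). \<sigma> x)"

definition mult_grp :: "'c::field set \<Rightarrow> 'c monoid" where
  "mult_grp E = \<lparr>carrier = E, mult = (*), one = 1\<rparr>"


section \<open>Function fields and their places\<close>

definition function_field :: "'c::field set \<Rightarrow> 'c set \<Rightarrow> bool" where
  \<comment> \<open>\<open>F\<close> algebraically closed in \<open>K\<close> is geometric connectedness of the smooth projective model\<close>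
  "function_field F K \<longleftrightarrow> is_subfield F \<and> finite F \<and> is_subfield K \<and> F \<subseteq> K
     \<and> (\<exists>t\<in>K. \<not> algebraic_over F t \<and> finite_ext (is_subfield hull (insert t F)) K)
     \<and> (\<forall>x\<in>K. algebraic_over F x \<longrightarrow> x \<in> F)"

text \<open>
  A place is a normalized discrete valuation; the value \<open>0\<close> at \<open>0\<close> and outside \<open>K\<close> is a dummy that
  makes the valuation unique as a function.
\<close>

definition places :: "'c::field set \<Rightarrow> ('c \<Rightarrow> int) set" where
  "places K = {v. (\<forall>x\<in>K - {0}. \<forall>y\<in>K - {0}. v (x * y) = v x + v y
                    \<and> (x + y \<noteq> 0 \<longrightarrow> min (v x) (v y) \<le> v (x + y)))
                \<and> v ` (K - {0}) = UNIV \<and> (\<forall>x. x \<notin> K - {0} \<longrightarrow> v x = 0)}"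

definition val_ge :: "('c::field \<Rightarrow> int) \<Rightarrow> int \<Rightarrow> 'c \<Rightarrow> bool" where
  "val_ge v n x \<longleftrightarrow> x = 0 \<or> n \<le> v x"

definition place_degree :: "'c::field set \<Rightarrow> 'c set \<Rightarrow> ('c \<Rightarrow> int) \<Rightarrow> nat" where
  \<comment> \<open>the residue field is an \<open>F\<close>-vector space of dimension \<open>d\<close>, i.e. has \<open>|F|^d\<close> elements\<close>
  "place_degree F K v = (THE d. card ({x \<in> K. val_ge v 0 x} //
     {(x, y). x \<in> K \<and> y \<in> K \<and> val_ge v 0 x \<and> val_ge v 0 y \<and> val_ge v 1 (x - y)}) = card F ^ d)"


section \<open>The place at infinity\<close>

record 'c ff_infinity =
  res_char :: nat                (* p *)
  const_fld :: "'c set"          (* F_q *)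
  fun_fld :: "'c set"            (* K *)
  val_inf :: "'c \<Rightarrow> int"         (* the valuation of K at infinity *)
  absval :: "'c \<Rightarrow> real"         (* the absolute value of C_infinity *)
  unif :: "'c"                   (* u_infinity *)

definition K_inf :: "('c::{field,complete_space}) ff_infinity \<Rightarrow> 'c set" where
  "K_inf S = closure (fun_fld S)"

definition uniformizer :: "('c::{field,complete_space}) ff_infinity \<Rightarrow> 'c \<Rightarrow> bool" where
  "uniformizer S w \<longleftrightarrow> w \<in> K_inf S \<and> w \<noteq> 0 \<and> absval S w < 1
     \<and> (\<forall>x\<in>K_inf S. absval S x < 1 \<longrightarrow> absval S x \<le> absval S w)"

text \<open>
  The last two assumptions say that the ambient field is the completion of an algebraic closure of
  \<open>K_inf\<close>. The absolute value is only required to induce the place at infinity; its normalization is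
  irrelevant.
\<close>

locale ff_infinity =
  fixes S :: "('c::{field,complete_space}) ff_infinity"
  assumes prime_char: "prime (res_char S)"
    and card_const: "\<exists>r\<ge>1. card (const_fld S) = res_char S ^ r"
    and function_field: "function_field (const_fld S) (fun_fld S)"
    and place: "val_inf S \<in> places (fun_fld S)"
    and absval_0: "absval S 0 = 0"
    and absval_pos: "x \<noteq> 0 \<Longrightarrow> absval S x > 0"
    and absval_mult: "absval S (x * y) = absval S x * absval S y"
    and absval_ultra: "absval S (x + y) \<le> max (absval S x) (absval S y)"
    and dist_absval: "dist x y = absval S (x - y)"
    and absval_place: "\<exists>c>1. \<forall>x\<in>fun_fld S - {0}. absval S x = c powi (- val_inf S x)"
    and unif: "uniformizer S (unif S)"
    and alg_closure: "degree P > 0 \<Longrightarrow> (\<forall>i. algebraic_over (K_inf S) (coeff P i)) \<Longrightarrow>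
          \<exists>x. algebraic_over (K_inf S) x \<and> poly P x = 0"
    and alg_dense: "closure {x. algebraic_over (K_inf S) x} = UNIV"

definition fin_places :: "('c::{field,complete_space}) ff_infinity \<Rightarrow> ('c \<Rightarrow> int) set" where
  "fin_places S = places (fun_fld S) - {val_inf S}"

definition ring_A :: "('c::{field,complete_space}) ff_infinity \<Rightarrow> 'c set" where
  "ring_A S = {x \<in> fun_fld S. \<forall>v\<in>fin_places S. val_ge v 0 x}"

definition deg_inf :: "('c::{field,complete_space}) ff_infinity \<Rightarrow> nat" where
  "deg_inf S = place_degree (const_fld S) (fun_fld S) (val_inf S)"

definition ord_inf :: "('c::{field,complete_space}) ff_infinity \<Rightarrow> 'c \<Rightarrow> int" where
  "ord_inf S x = (THE n. absval S x = absval S (unif S) powi n)"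

definition units_inf :: "('c::{field,complete_space}) ff_infinity \<Rightarrow> 'c set" where
  "units_inf S = {x \<in> K_inf S. absval S x = 1}"

definition one_units :: "('c::{field,complete_space}) ff_infinity \<Rightarrow> 'c set" where
  "one_units S = {x \<in> K_inf S. absval S (x - 1) < 1}"

definition K_pos :: "('c::{field,complete_space}) ff_infinity \<Rightarrow> 'c set" where
  "K_pos S = {unif S powi n * w | n w. w \<in> one_units S}"

definition ang :: "('c::{field,complete_space}) ff_infinity \<Rightarrow> 'c \<Rightarrow> 'c" where
  "ang S x = x / unif S powi (ord_inf S x)"

definition deg :: "('c::{field,complete_space}) ff_infinity \<Rightarrow> 'c \<Rightarrow> int" where
  "deg S x = - int (deg_inf S) * ord_inf S x"


section \<open>The local Artin homomorphism\<close>

definition K_ab :: "('c::{field,complete_space}) ff_infinity \<Rightarrow> 'c set" where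
  "K_ab S = is_subfield hull (\<Union>{E. abelian_ext (K_inf S) E})"

definition unramified_ext :: "('c::{field,complete_space}) ff_infinity \<Rightarrow> 'c set \<Rightarrow> bool" where
  \<comment> \<open>ramification index \<open>1\<close>; the residue fields are finite, so no separability condition is needed\<close>
  "unramified_ext S E \<longleftrightarrow> finite_ext (K_inf S) E \<and> absval S ` E = absval S ` K_inf S"

definition K_un :: "('c::{field,complete_space}) ff_infinity \<Rightarrow> 'c set" where
  "K_un S = is_subfield hull (\<Union>{E. unramified_ext S E})"

definition inertia :: "('c::{field,complete_space}) ff_infinity \<Rightarrow> ('c \<Rightarrow> 'c) set" where
  "inertia S = carrier (gal (K_ab S) (K_un S))"

definition frobenius_lift :: "('c::{field,complete_space}) ff_infinity \<Rightarrow> ('c \<Rightarrow> 'c) \<Rightarrow> bool" where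
  "frobenius_lift S \<sigma> \<longleftrightarrow> \<sigma> \<in> carrier (gal (K_ab S) (K_inf S)) \<and>
     (\<forall>x\<in>K_un S. absval S x \<le> 1 \<longrightarrow>
        absval S (\<sigma> x - x ^ (card (const_fld S) ^ deg_inf S)) < 1)"

text \<open>
  The standard characterization of the local Artin (reciprocity) homomorphism: uniformizers act as
  Frobenius on the maximal unramified extension, and for each finite abelian \<open>E\<close> the map induces an
  isomorphism of \<open>K_inf\<^sup>*\<close> modulo norms from \<open>E\<close> with the Galois group of \<open>E\<close>.
\<close>

definition local_artin ::
    "('c::{field,complete_space}) ff_infinity \<Rightarrow> ('c \<Rightarrow> 'c \<Rightarrow> 'c) \<Rightarrow> bool" where
  "local_artin S \<Theta> \<longleftrightarrow>
     \<Theta> \<in> hom (mult_grp (K_inf S - {0})) (gal (K_ab S) (K_inf S)) \<and>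
     (\<forall>w. uniformizer S w \<longrightarrow> frobenius_lift S (\<Theta> w)) \<and>
     (\<forall>E. abelian_ext (K_inf S) E \<longrightarrow>
        {a \<in> K_inf S - {0}. \<forall>x\<in>E. \<Theta> a x = x} = galois_norm E (K_inf S) ` (E - {0}) \<and>
        (\<lambda>a. restrict (\<Theta> a) E) ` (K_inf S - {0}) = carrier (gal E (K_inf S)))"


section \<open>The p-adic integers and the exponent group\<close>

text \<open>\<open>Z\<^sub>p\<close> is the inverse limit of \<open>Z/p\<^sup>n\<close>, with the topology of a product of discrete spaces.\<close>

type_synonym padic = "nat \<Rightarrow> int"

definition padics :: "nat \<Rightarrow> padic set" where
  "padics p = {y. \<forall>n. 0 \<le> y n \<and> y n < int p ^ n \<and> y (Suc n) mod int p ^ n = y n}"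

definition padic_add :: "nat \<Rightarrow> padic \<Rightarrow> padic \<Rightarrow> padic" where
  "padic_add p y z = (\<lambda>n. (y n + z n) mod int p ^ n)"

definition padic_choose :: "nat \<Rightarrow> padic \<Rightarrow> nat \<Rightarrow> padic" where
  \<comment> \<open>the limit in \<open>Z\<^sub>p\<close> of the integers \<open>y n choose j\<close>\<close>
  "padic_choose p y j =
     (\<lambda>m. THE r. \<forall>\<^sub>F n in sequentially. int (nat (y n) choose j) mod int p ^ m = r)"

definition padic_pow :: "nat \<Rightarrow> ('c::{field,complete_space}) \<Rightarrow> padic \<Rightarrow> 'c" where
  \<comment> \<open>\<open>Z\<^sub>p\<close> acts on a field of characteristic \<open>p\<close> through the residue modulo \<open>p\<close>\<close>
  "padic_pow p w y = (\<Sum>j. of_int (padic_choose p y j 1) * (w - 1) ^ j)"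

type_synonym 'c expt = "'c \<times> padic"

definition S_add :: "nat \<Rightarrow> 'c::field expt \<Rightarrow> 'c expt \<Rightarrow> 'c expt" where
  "S_add p s t = (fst s * fst t, padic_add p (snd s) (snd t))"

definition S_zero :: "'c::field expt" where
  "S_zero = (1, \<lambda>n. 0)"

definition S_sum :: "nat \<Rightarrow> 'c::field expt list \<Rightarrow> 'c expt" where
  "S_sum p ss = foldr (S_add p) ss S_zero"

definition expo :: "('c::{field,complete_space}) ff_infinity \<Rightarrow> 'c \<Rightarrow> 'c expt \<Rightarrow> 'c" where
  "expo S x s = fst s powi (deg S x) * padic_pow (res_char S) (ang S x) (snd s)"

definition compact_td_subgroup :: "('c::{field,complete_space}) set \<Rightarrow> bool" where
  "compact_td_subgroup G \<longleftrightarrow> subgroup G (mult_grp (UNIV - {0})) \<and> compact G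
     \<and> (\<forall>x\<in>G. connected_component_set G x = {x})"


section \<open>Fractional ideals\<close>

definition frac_ideals :: "('c::{field,complete_space}) ff_infinity \<Rightarrow> 'c set set" where
  "frac_ideals S = {I. I \<subseteq> fun_fld S \<and> 0 \<in> I \<and> I \<noteq> {0}
     \<and> (\<forall>x\<in>I. \<forall>y\<in>I. x + y \<in> I) \<and> (\<forall>a\<in>ring_A S. \<forall>x\<in>I. a * x \<in> I)
     \<and> (\<exists>c\<in>ring_A S - {0}. (*) c ` I \<subseteq> ring_A S)}"

definition ideal_mult :: "'c::field set \<Rightarrow> 'c set \<Rightarrow> 'c set" where
  "ideal_mult I J = {(\<Sum>i<n. x i * y i) | (n::nat) x y. \<forall>i<n. x i \<in> I \<and> y i \<in> J}"

definition ideal_val :: "('c::field \<Rightarrow> int) \<Rightarrow> 'c set \<Rightarrow> int" where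
  "ideal_val v I = Inf (v ` (I - {0}))"

definition ideal_deg :: "('c::{field,complete_space}) ff_infinity \<Rightarrow> 'c set \<Rightarrow> int" where
  "ideal_deg S I = (\<Sum>v\<in>{v \<in> fin_places S. ideal_val v I \<noteq> 0}.
     int (place_degree (const_fld S) (fun_fld S) v) * ideal_val v I)"

definition ideal_ang :: "('c::{field,complete_space}) ff_infinity \<Rightarrow> 'c set \<Rightarrow> 'c" where
  "ideal_ang S = (THE \<psi>.
     (\<forall>I\<in>frac_ideals S. absval S (\<psi> I - 1) < 1) \<and>
     (\<forall>I\<in>frac_ideals S. \<forall>J\<in>frac_ideals S. \<psi> (ideal_mult I J) = \<psi> I * \<psi> J) \<and>
     (\<forall>a\<in>fun_fld S \<inter> K_pos S. \<psi> ((*) a ` ring_A S) = ang S a) \<and>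
     (\<forall>I. I \<notin> frac_ideals S \<longrightarrow> \<psi> I = 1))"

definition ideal_expo ::
    "('c::{field,complete_space}) ff_infinity \<Rightarrow> 'c set \<Rightarrow> 'c expt \<Rightarrow> 'c" where
  "ideal_expo S I s = fst s powi (ideal_deg S I) * padic_pow (res_char S) (ideal_ang S I) (snd s)"


section \<open>Finite adeles\<close>

text \<open>
  The completion of \<open>K\<close> at \<open>v\<close> is represented by \<open>v\<close>-adic Cauchy sequences in \<open>K\<close> modulo null
  sequences. A finite adele is a family of such sequences indexed by the finite places, and
  \<open>adele_eq\<close> is equality of finite adeles.
\<close>

type_synonym 'c adele = "('c \<Rightarrow> int) \<Rightarrow> nat \<Rightarrow> 'c"

definition v_cauchy :: "'c::field set \<Rightarrow> ('c \<Rightarrow> int) \<Rightarrow> (nat \<Rightarrow> 'c) \<Rightarrow> bool" where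
  "v_cauchy K v x \<longleftrightarrow> range x \<subseteq> K \<and> (\<forall>N. \<exists>M. \<forall>m\<ge>M. \<forall>n\<ge>M. val_ge v N (x m - x n))"

definition v_integral :: "('c::field \<Rightarrow> int) \<Rightarrow> (nat \<Rightarrow> 'c) \<Rightarrow> bool" where
  "v_integral v x \<longleftrightarrow> (\<forall>\<^sub>F n in sequentially. val_ge v 0 (x n))"

definition finite_adeles :: "('c::{field,complete_space}) ff_infinity \<Rightarrow> 'c adele set" where
  "finite_adeles S = {a. (\<forall>v\<in>fin_places S. v_cauchy (fun_fld S) v (a v))
     \<and> finite {v \<in> fin_places S. \<not> v_integral v (a v)}}"

definition adele_R :: "('c::{field,complete_space}) ff_infinity \<Rightarrow> 'c adele set" where
  "adele_R S = {a \<in> finite_adeles S. \<forall>v\<in>fin_places S. v_integral v (a v)}"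

definition adele_eq ::
    "('c::{field,complete_space}) ff_infinity \<Rightarrow> 'c adele \<Rightarrow> 'c adele \<Rightarrow> bool" where
  "adele_eq S a b \<longleftrightarrow>
     (\<forall>v\<in>fin_places S. \<forall>N. \<forall>\<^sub>F n in sequentially. val_ge v N (a v n - b v n))"

definition adele_of :: "'c \<Rightarrow> 'c adele" where
  "adele_of x = (\<lambda>v n. x)"

definition adele_mult :: "'c::field adele \<Rightarrow> 'c adele \<Rightarrow> 'c adele" where
  "adele_mult a b = (\<lambda>v n. a v n * b v n)"

definition adele_diff :: "'c::field adele \<Rightarrow> 'c adele \<Rightarrow> 'c adele" where
  "adele_diff a b = (\<lambda>v n. a v n - b v n)"

definition adele_in ::
    "('c::{field,complete_space}) ff_infinity \<Rightarrow> 'c adele \<Rightarrow> 'c adele \<Rightarrow> bool" where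
  \<comment> \<open>membership of \<open>a\<close> in \<open>R h\<close>\<close>
  "adele_in S a h \<longleftrightarrow> (\<exists>r\<in>adele_R S. adele_eq S a (adele_mult r h))"


section \<open>Lattices and commensurability\<close>

type_synonym 'c lattice = "'c set \<times> ('c set \<Rightarrow> 'c set)"

definition coset :: "'c::field set \<Rightarrow> 'c \<Rightarrow> 'c set" where
  "coset M x = (+) x ` M"

definition lattices :: "('c::{field,complete_space}) ff_infinity \<Rightarrow> 'c lattice set" where
  "lattices S = {(\<Lambda>, \<phi>). \<Lambda> \<in> frac_ideals S
     \<and> \<phi> \<in> (coset (ring_A S) ` fun_fld S) \<rightarrow>\<^sub>E (coset \<Lambda> ` fun_fld S)
     \<and> (\<forall>x\<in>fun_fld S. \<forall>y\<in>fun_fld S.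
          \<forall>x'\<in>\<phi> (coset (ring_A S) x). \<forall>y'\<in>\<phi> (coset (ring_A S) y).
            x' + y' \<in> \<phi> (coset (ring_A S) (x + y)))
     \<and> (\<forall>a\<in>ring_A S. \<forall>x\<in>fun_fld S. \<forall>x'\<in>\<phi> (coset (ring_A S) x).
            a * x' \<in> \<phi> (coset (ring_A S) (a * x)))}"

text \<open>
  Here \<open>h\<close> is the inverse of the finite idele \<open>g\<close>: the ideal is \<open>R h \<inter> K\<close>, and \<open>\<phi>\<close> is multiplication
  by \<open>\<rho> h\<close> under the identification of \<open>K/\<Lambda>\<close> with the finite adeles modulo \<open>R h\<close>.
\<close>

definition adelic_data :: "('c::{field,complete_space}) ff_infinity \<Rightarrow> 'c lattice
    \<Rightarrow> 'c adele \<Rightarrow> 'c adele \<Rightarrow> 'c adele \<Rightarrow> bool" where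
  "adelic_data S L g h \<rho> \<longleftrightarrow>
     g \<in> finite_adeles S \<and> h \<in> finite_adeles S \<and> adele_eq S (adele_mult g h) (adele_of 1)
     \<and> \<rho> \<in> adele_R S
     \<and> fst L = {x \<in> fun_fld S. adele_in S (adele_of x) h}
     \<and> (\<forall>x\<in>fun_fld S. \<forall>y\<in>snd L (coset (ring_A S) x).
          adele_in S (adele_diff (adele_of y) (adele_mult (adele_mult \<rho> h) (adele_of x))) h)"

definition commens :: "('c::{field,complete_space}) ff_infinity \<Rightarrow> 'c lattice \<Rightarrow> 'c lattice \<Rightarrow> bool"
  where
  "commens S L L' \<longleftrightarrow> L \<in> lattices S \<and> L' \<in> lattices S \<and>
     (\<exists>g h \<rho> g' h' \<rho>'. adelic_data S L g h \<rho> \<and> adelic_data S L' g' h' \<rho>'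
        \<and> adele_eq S (adele_mult \<rho> h) (adele_mult \<rho>' h'))"

definition lattice_scale ::
    "('c::{field,complete_space}) ff_infinity \<Rightarrow> 'c \<Rightarrow> 'c lattice \<Rightarrow> 'c lattice" where
  "lattice_scale S k L =
     ((*) k ` fst L, \<lambda>X\<in>coset (ring_A S) ` fun_fld S. (*) k ` snd L X)"

text \<open>
  A scaled lattice \<open>\<lambda>L\<close> is kept in the presented form \<open>(\<lambda>, L)\<close>. The defining formula of \<open>X\<^sub>f\<close> uses
  the factor \<open>\<lambda>\<close> itself: replacing \<open>(\<lambda>, L)\<close> by \<open>(\<lambda>/k, kL)\<close> with \<open>k\<close> in \<open>K \<inter> K_pos\<close>, which presents the same
  lattice in \<open>K_inf\<close>, multiplies its integrand by \<open>k\<close> to the power \<open>-s\<close>.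
\<close>

type_synonym 'c scaled_lattice = "'c \<times> 'c lattice"

definition presented ::
    "('c::{field,complete_space}) ff_infinity \<Rightarrow> 'c scaled_lattice \<Rightarrow> 'c lattice" where
  "presented S P = lattice_scale S (fst P) (snd P)"

definition rescale :: "'c::field \<Rightarrow> 'c scaled_lattice \<Rightarrow> 'c scaled_lattice" where
  "rescale \<gamma> P = (\<gamma> * fst P, snd P)"

lemma presented_rescale: "presented S (rescale \<gamma> P) = lattice_scale S \<gamma> (presented S P)"
  unfolding presented_def rescale_def lattice_scale_def
  by (auto simp: image_image mult.assoc restrict_def fun_eq_iff)


section \<open>The convolution algebra and the time evolution\<close>

text \<open>Fractional ideals form a discrete space, and the maps \<open>\<phi>\<close> carry pointwise convergence.\<close>

definition lattice_topology ::
    "('c::{field,complete_space}) ff_infinity \<Rightarrow> 'c lattice topology" where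
  "lattice_topology S = subtopology (prod_topology (discrete_topology UNIV)
     (product_topology (\<lambda>_. discrete_topology UNIV) (coset (ring_A S) ` fun_fld S))) (lattices S)"

definition pair_topology ::
    "('c::{field,complete_space}) ff_infinity \<Rightarrow> ('c lattice \<times> 'c lattice) topology" where
  "pair_topology S = subtopology (prod_topology (lattice_topology S) (lattice_topology S))
     {(L, L'). commens S L L'}"

type_synonym 'c coeff = "'c lattice \<times> 'c lattice \<Rightarrow> 'c"

text \<open>By invariance, supports are compact in the quotient by the scaling action of \<open>K\<^sup>*\<close>.\<close>

definition alg :: "('c::{field,complete_space}) ff_infinity \<Rightarrow> 'c coeff set" where
  "alg S = {f. continuous_map (pair_topology S) euclidean f
     \<and> (\<forall>L L'. \<not> commens S L L' \<longrightarrow> f (L, L') = 0)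
     \<and> (\<forall>k\<in>fun_fld S - {0}. \<forall>L L'. commens S L L' \<longrightarrow>
          f (lattice_scale S k L, lattice_scale S k L') = f (L, L'))
     \<and> (\<exists>C. compactin (pair_topology S) C \<and> (\<forall>L L'. f (L, L') \<noteq> 0 \<longrightarrow>
          (\<exists>k\<in>fun_fld S - {0}. \<exists>(M, M')\<in>C. L = lattice_scale S k M \<and> L' = lattice_scale S k M')))}"

definition conv ::
    "('c::{field,complete_space}) ff_infinity \<Rightarrow> 'c coeff \<Rightarrow> 'c coeff \<Rightarrow> 'c coeff" where
  "conv S f g = (\<lambda>(L, L'). \<Sum>M\<in>{M. commens S L M \<and> f (L, M) * g (M, L') \<noteq> 0}. f (L, M) * g (M, L'))"

definition conv_one :: "('c::{field,complete_space}) ff_infinity \<Rightarrow> 'c coeff" where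
  "conv_one S = (\<lambda>(L, L'). if L \<in> lattices S \<and> L = L' then 1 else 0)"

definition time_ev :: "('c::{field,complete_space}) ff_infinity \<Rightarrow> 'c expt \<Rightarrow> 'c coeff \<Rightarrow> 'c coeff"
  where
  "time_ev S s f = (\<lambda>(L, L'). ideal_expo S (fst L) s / ideal_expo S (fst L') s * f (L, L'))"

text \<open>\<open>C(H, alg)\<close>, with the supremum norm on the algebra.\<close>

definition cont_alg ::
    "('c::{field,complete_space}) ff_infinity \<Rightarrow> 'c expt set \<Rightarrow> ('c expt \<Rightarrow> 'c coeff) set" where
  "cont_alg S H = {l. \<forall>s\<in>H. l s \<in> alg S \<and> uniform_limit UNIV l (l s) (at s within H)}"


section \<open>Non-archimedean measures and integrals\<close>

definition clopen_in :: "'a::topological_space set \<Rightarrow> 'a set \<Rightarrow> bool" where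
  "clopen_in H E \<longleftrightarrow> openin (top_of_set H) E \<and> closedin (top_of_set H) E"

definition na_measure ::
    "('c::{field,complete_space}) ff_infinity \<Rightarrow> 'a::topological_space set \<Rightarrow> ('a set \<Rightarrow> 'c) \<Rightarrow> bool"
  where
  "na_measure S H \<mu> \<longleftrightarrow> (\<forall>E. clopen_in H E \<longrightarrow> \<mu> E \<in> K_inf S)
     \<and> (\<forall>E E'. clopen_in H E \<and> clopen_in H E' \<and> E \<inter> E' = {} \<longrightarrow> \<mu> (E \<union> E') = \<mu> E + \<mu> E')
     \<and> (\<exists>B. \<forall>E. clopen_in H E \<longrightarrow> absval S (\<mu> E) \<le> B)"

definition clopen_partition :: "'a::topological_space set \<Rightarrow> 'a set set \<Rightarrow> bool" where
  "clopen_partition H Q \<longleftrightarrow> finite Q \<and> partition_on H Q \<and> (\<forall>E\<in>Q. clopen_in H E)"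

definition has_na_integral :: "('c \<Rightarrow> 'b \<Rightarrow> 'b) \<Rightarrow> 'a::topological_space set \<Rightarrow> ('a set \<Rightarrow> 'c)
    \<Rightarrow> ('a \<Rightarrow> 'b::{ab_group_add,metric_space}) \<Rightarrow> 'b \<Rightarrow> bool" where
  \<comment> \<open>limit of Riemann sums along refinement of clopen partitions\<close>
  "has_na_integral scl H \<mu> g I \<longleftrightarrow> (\<forall>\<epsilon>>0. \<exists>P. clopen_partition H P \<and>
     (\<forall>Q. clopen_partition H Q \<and> refines H Q P \<longrightarrow>
        (\<forall>t. (\<forall>E\<in>Q. t E \<in> E) \<longrightarrow> dist (\<Sum>E\<in>Q. scl (\<mu> E) (g (t E))) I < \<epsilon>)))"

definition na_integral :: "('c \<Rightarrow> 'b \<Rightarrow> 'b) \<Rightarrow> 'a::topological_space set \<Rightarrow> ('a set \<Rightarrow> 'c)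
    \<Rightarrow> ('a \<Rightarrow> 'b::{ab_group_add,metric_space}) \<Rightarrow> 'b" where
  "na_integral scl H \<mu> g = (THE I. has_na_integral scl H \<mu> g I)"


section \<open>The dual system and its scaling action\<close>

text \<open>
  An element of the dual system is represented by its coefficient functions: the value at a word
  \<open>[s\<^sub>1, \<dots>, s\<^sub>n]\<close> is the coefficient of \<open>U\<close> at \<open>s\<^sub>1 + \<dots> + s\<^sub>n\<close> in the \<open>n\<close>-fold integral over \<open>H\<close>
  against \<open>\<mu>\<close>. The generator given by \<open>l\<close> lives on words of length one, and the product follows from
  the rule that moving \<open>U\<close> at \<open>s\<close> past a coefficient applies the time evolution at \<open>s\<close>.
\<close>

type_synonym 'c dual = "'c expt list \<Rightarrow> 'c coeff"

definition dual_gen :: "'c expt set \<Rightarrow> ('c::field expt \<Rightarrow> 'c coeff) \<Rightarrow> 'c dual" where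
  "dual_gen H l = (\<lambda>ss P. case ss of [s] \<Rightarrow> (if s \<in> H then l s P else 0) | _ \<Rightarrow> 0)"

definition dual_mult ::
    "('c::{field,complete_space}) ff_infinity \<Rightarrow> 'c dual \<Rightarrow> 'c dual \<Rightarrow> 'c dual" where
  "dual_mult S f g = (\<lambda>ss P. \<Sum>i\<le>length ss.
     conv S (f (take i ss)) (time_ev S (S_sum (res_char S) (take i ss)) (g (drop i ss))) P)"

inductive_set dual_system ::
    "('c::{field,complete_space}) ff_infinity \<Rightarrow> 'c expt set \<Rightarrow> 'c dual set"
  for S H where
    gen: "l \<in> cont_alg S H \<Longrightarrow> dual_gen H l \<in> dual_system S H"
  | scale: "f \<in> dual_system S H \<Longrightarrow> (\<lambda>ss P. c * f ss P) \<in> dual_system S H"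
  | add: "f \<in> dual_system S H \<Longrightarrow> g \<in> dual_system S H \<Longrightarrow> (\<lambda>ss P. f ss P + g ss P) \<in> dual_system S H"
  | mult: "f \<in> dual_system S H \<Longrightarrow> g \<in> dual_system S H \<Longrightarrow> dual_mult S f g \<in> dual_system S H"

definition theta :: "('c::{field,complete_space}) ff_infinity \<Rightarrow> 'c \<Rightarrow> 'c dual \<Rightarrow> 'c dual" where
  "theta S x f = (\<lambda>ss P. expo S x (S_sum (res_char S) ss) * f ss P)"

definition theta_Zp :: "('c::{field,complete_space}) ff_infinity \<Rightarrow> 'c \<Rightarrow> 'c dual \<Rightarrow> 'c dual" where
  "theta_Zp S x f =
     (\<lambda>ss P. padic_pow (res_char S) (ang S x) (snd (S_sum (res_char S) ss)) * f ss P)"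

definition theta_G :: "('c::{field,complete_space}) ff_infinity \<Rightarrow> 'c \<Rightarrow> 'c dual \<Rightarrow> 'c dual" where
  "theta_G S x f = (\<lambda>ss P. fst (S_sum (res_char S) ss) powi (deg S x) * f ss P)"

lemma theta_eq: "theta S x f = theta_G S x (theta_Zp S x f)"
  by (simp add: theta_def theta_G_def theta_Zp_def expo_def mult.assoc)


section \<open>Operators implementing the time evolution, and the map X\<close>

locale na_banach = vector_space scl
  for S :: "('c::{field,complete_space}) ff_infinity"
    and scl :: "'c \<Rightarrow> 'b::{ab_group_add,complete_space} \<Rightarrow> 'b"
    and nrm :: "'b \<Rightarrow> real" +
  assumes nrm_ultra: "nrm (x + y) \<le> max (nrm x) (nrm y)"
    and nrm_scl: "nrm (scl a x) = absval S a * nrm x"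
    and nrm_dist: "dist x y = nrm (x - y)"

definition bounded_op ::
    "('c::field \<Rightarrow> 'b::ab_group_add \<Rightarrow> 'b) \<Rightarrow> ('b \<Rightarrow> real) \<Rightarrow> ('b \<Rightarrow> 'b) \<Rightarrow> bool" where
  "bounded_op scl nrm T \<longleftrightarrow> Vector_Spaces.linear scl scl T \<and> (\<exists>M. \<forall>x. nrm (T x) \<le> M * nrm x)"

definition alg_rep :: "('c::{field,complete_space}) ff_infinity
    \<Rightarrow> ('c \<Rightarrow> 'b::ab_group_add \<Rightarrow> 'b) \<Rightarrow> ('b \<Rightarrow> real) \<Rightarrow> ('c coeff \<Rightarrow> 'b \<Rightarrow> 'b) \<Rightarrow> bool" where
  "alg_rep S scl nrm \<pi> \<longleftrightarrow> (\<forall>a\<in>alg S. bounded_op scl nrm (\<pi> a)) \<and> \<pi> (conv_one S) = id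
     \<and> (\<forall>a\<in>alg S. \<forall>b\<in>alg S. \<pi> (\<lambda>P. a P + b P) = (\<lambda>x. \<pi> a x + \<pi> b x)
          \<and> \<pi> (conv S a b) = \<pi> a \<circ> \<pi> b)
     \<and> (\<forall>a\<in>alg S. \<forall>c. \<pi> (\<lambda>P. c * a P) = (\<lambda>x. scl c (\<pi> a x)))"

definition implements_time_ev :: "('c::{field,complete_space}) ff_infinity
    \<Rightarrow> ('c \<Rightarrow> 'b::ab_group_add \<Rightarrow> 'b) \<Rightarrow> ('b \<Rightarrow> real) \<Rightarrow> 'c expt set
    \<Rightarrow> ('c coeff \<Rightarrow> 'b \<Rightarrow> 'b) \<Rightarrow> ('c expt \<Rightarrow> 'b \<Rightarrow> 'b) \<Rightarrow> bool" where
  "implements_time_ev S scl nrm H \<pi> U \<longleftrightarrow> alg_rep S scl nrm \<pi>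
     \<and> (\<forall>s\<in>H. bounded_op scl nrm (U s)) \<and> U S_zero = id
     \<and> (\<forall>s\<in>H. \<forall>t\<in>H. U (S_add (res_char S) s t) = U s \<circ> U t)
     \<and> (\<forall>s\<in>H. \<forall>a\<in>alg S. U s \<circ> \<pi> a = \<pi> (time_ev S s a) \<circ> U s)"

text \<open>
  The formula for \<open>X\<^sub>f\<close> with \<open>f\<close> a generator, whose coefficient function is \<open>s \<mapsto> f [s]\<close>, at a pair of
  lattices scaled by the same factor. The operator-valued integral is taken pointwise on the Banach
  space.
\<close>

definition X_map :: "('c::{field,complete_space}) ff_infinity
    \<Rightarrow> ('c \<Rightarrow> 'b::{ab_group_add,complete_space} \<Rightarrow> 'b) \<Rightarrow> 'c expt set \<Rightarrow> ('c expt set \<Rightarrow> 'c)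
    \<Rightarrow> ('c expt \<Rightarrow> 'b \<Rightarrow> 'b) \<Rightarrow> 'c dual \<Rightarrow> 'c scaled_lattice \<Rightarrow> 'c scaled_lattice \<Rightarrow> 'b \<Rightarrow> 'b" where
  "X_map S scl H \<mu> U f = (\<lambda>(x, L) (x', L') \<xi>.
     na_integral scl H \<mu> (\<lambda>s. scl (f [s] (L, L') * expo S x s) (U s \<xi>)))"

definition corresponds :: "('c::{field,complete_space}) ff_infinity
    \<Rightarrow> ('c \<Rightarrow> 'b::{ab_group_add,complete_space} \<Rightarrow> 'b) \<Rightarrow> 'c expt set \<Rightarrow> ('c expt set \<Rightarrow> 'c)
    \<Rightarrow> ('c expt \<Rightarrow> 'b \<Rightarrow> 'b) \<Rightarrow> ('c dual \<Rightarrow> 'c dual) \<Rightarrow> 'c \<Rightarrow> bool" where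
  "corresponds S scl H \<mu> U T \<gamma> \<longleftrightarrow> (\<forall>l\<in>cont_alg S H. \<forall>x\<in>K_pos S. \<forall>L L'. commens S L L' \<longrightarrow>
     X_map S scl H \<mu> U (T (dual_gen H l)) (x, L) (x, L')
       = X_map S scl H \<mu> U (dual_gen H l) (rescale \<gamma> (x, L)) (rescale \<gamma> (x, L')))"

end

theory Submission
  imports Defs
begin

text \<open>
  A one-unit \<open>w\<close> satisfies \<open>w\<^sup>y = lim w ^ (y mod p\<^sup>n)\<close>: in characteristic \<open>p\<close> the binomial
  coefficients \<open>y choose j\<close> with \<open>j < p\<^sup>n\<close> depend only on \<open>y mod p\<^sup>n\<close>, so the partial sum of the
  binomial series up to \<open>p\<^sup>n\<close> equals \<open>w ^ (y mod p\<^sup>n)\<close>. Hence the exponentiation is multiplicative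
  in \<open>w\<close>, as are both factors of \<open>\<lambda>\<^sup>s\<close>, and each restriction of the scaling action multiplies the
  integrand of \<open>X\<^sub>f\<close> by the power \<open>\<gamma>\<^sup>s\<close> that \<open>\<lambda> \<mapsto> \<gamma>\<lambda>\<close> produces. The one-units are the elements
  of \<open>K_pos\<close> of absolute value \<open>1\<close>, so injectivity of the Artin map identifies them with the part
  of \<open>K_pos\<close> that maps to inertia.
\<close>

section \<open>Binomial coefficients modulo p\<close>

text \<open>Absorption gives \<open>k * (p ^ n choose k) = p ^ n * (p ^ n - 1 choose k - 1)\<close>.
  If p did not divide the binomial coefficient, \<open>p ^ n\<close> would divide \<open>k\<close>,
  which is positive and smaller.\<close>

lemma prime_dvd_prime_power_choose:
  assumes "prime p" "0 < k" "k < p ^ n"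
  shows "p dvd (p ^ n choose k)"
proof (rule ccontr)
  assume "\<not> p dvd (p ^ n choose k)"
  then have "coprime (p ^ n) (p ^ n choose k)"
    using assms(1) by (simp add: prime_imp_coprime)
  moreover have "p ^ n dvd k * (p ^ n choose k)"
    using times_binomial_minus1_eq[OF assms(2), of "p ^ n"] by simp
  ultimately have "p ^ n dvd k"
    using coprime_dvd_mult_left_iff by blast
  then show False
    using assms(2,3) nat_dvd_not_less by blast
qed

text \<open>In Vandermonde's sum over \<open>k\<close>, every term except \<open>k = 0\<close>
  contains \<open>p ^ n choose k\<close>. The terms that occur have
  \<open>k \<le> j < p ^ n\<close>, so this factor is divisible by p.\<close>

lemma choose_add_prime_power_mod:
  assumes "prime p" "j < p ^ n"
  shows "((a + p ^ n) choose j) mod p = (a choose j) mod p"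
proof -
  let ?t = "\<lambda>k. (p ^ n choose k) * (a choose (j - k))"
  have "p dvd sum ?t ({..j} - {0})"
    using assms by (intro dvd_sum dvd_mult2 prime_dvd_prime_power_choose) auto
  moreover have "(a + p ^ n) choose j = (a choose j) + sum ?t ({..j} - {0})"
    unfolding add.commute[of a] vandermonde[symmetric] by (subst sum.remove[of _ 0]) auto
  ultimately show ?thesis
    by (auto elim!: dvdE)
qed

lemma choose_add_mult_prime_power_mod:
  assumes "prime p" "j < p ^ n"
  shows "((a + p ^ n * b) choose j) mod p = (a choose j) mod p"
proof (induction b)
  case (Suc b)
  then show ?case
    using choose_add_prime_power_mod[OF assms, of "a + p ^ n * b"] by (simp add: add_ac)
qed simp

section \<open>p-adic integers and their binomial coefficients\<close>

lemma padics_mod: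
  assumes "y \<in> padics p" "n \<le> m"
  shows "y m mod int p ^ n = y n"
  using assms(2)
proof (induction m rule: dec_induct)
  case base
  then show ?case using assms(1) by (simp add: padics_def)
next
  case (step m)
  have "y (Suc m) mod int p ^ n = y (Suc m) mod int p ^ m mod int p ^ n"
    using step(1) by (simp add: le_imp_power_dvd mod_mod_cancel)
  then show ?case
    using assms(1) step.IH by (simp add: padics_def)
qed

lemma padic_add_zero:
  assumes "y \<in> padics p"
  shows "padic_add p y (\<lambda>n. 0) = y"
  using assms by (simp add: padic_add_def padics_def fun_eq_iff)

text \<open>For \<open>n \<le> m\<close> the entries \<open>y m\<close> and \<open>y n\<close>
  differ by a multiple of \<open>p ^ n\<close>, so the residue of \<open>y m choose j\<close> is
  constant from index \<open>n\<close> on. This constant is what the definite description in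
  \<open>padic_choose\<close> selects at level 1.\<close>

lemma padic_choose_mod_p:
  assumes "prime p" "y \<in> padics p" "j < p ^ n"
  shows "padic_choose p y j 1 = int (nat (y n) choose j) mod int p"
proof -
  have "int (nat (y m) choose j) mod int p = int (nat (y n) choose j) mod int p" if "n \<le> m" for m
  proof -
    have y: "0 \<le> y n" "0 \<le> y m" using assms(2) by (auto simp: padics_def)
    have "nat (y m) mod p ^ n = nat (y n)"
      using padics_mod[OF assms(2) that] y by (metis nat_mod_distrib nat_int of_nat_0_le_iff of_nat_power)
    then have "nat (y m) = nat (y n) + p ^ n * (nat (y m) div p ^ n)"
      by (metis mod_mult_div_eq)
    then show ?thesis
      using choose_add_mult_prime_power_mod[OF assms(1,3)] by (metis zmod_int)
  qed
  then have ev: "\<forall>\<^sub>F m in sequentially.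
      int (nat (y m) choose j) mod int p = int (nat (y n) choose j) mod int p"
    unfolding eventually_sequentially by blast
  show ?thesis
    unfolding padic_choose_def
  proof (rule the_equality)
    fix r assume "\<forall>\<^sub>F m in sequentially. int (nat (y m) choose j) mod int p ^ 1 = r"
    \<comment> \<open>Two eventual values of one sequence agree: the resulting equation does not
      mention \<open>m\<close>, and \<open>sequentially\<close> is a nontrivial filter.\<close>
    with ev have "\<forall>\<^sub>F m::nat in sequentially. r = int (nat (y n) choose j) mod int p"
      by eventually_elim simp
    then show "r = int (nat (y n) choose j) mod int p" by simp
  qed (use ev in simp)
qed

section \<open>Subfields, their multiplicative groups and Galois groups\<close>

lemma is_subfield_power:
  assumes "is_subfield E" "x \<in> E"
  shows "x ^ n \<in> E"
proof (induction n)
  case 0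
  show ?case using assms(1) by (simp add: is_subfield_def)
next
  case (Suc n)
  then show ?case using assms by (simp add: is_subfield_def)
qed

lemma is_subfield_powi:
  assumes "is_subfield E" "x \<in> E"
  shows "x powi n \<in> E"
  using assms is_subfield_power[of E "x" "nat n"] is_subfield_power[of E "inverse x" "nat (- n)"]
  by (auto simp: power_int_def is_subfield_def)

text \<open>Translation by 1 permutes \<open>F\<close>, so adding 1 to each of the
  \<open>card F\<close> summands leaves the sum of all elements unchanged.\<close>

lemma of_nat_card_subfield:
  fixes F :: "'c::field set"
  assumes "is_subfield F" "finite F"
  shows "of_nat (card F) = (0::'c)"
proof -
  have add: "x + 1 \<in> F" if "x \<in> F" for x
    using assms(1) that unfolding is_subfield_def
    by (metis diff_0 diff_minus_eq_add)
  have diff: "x - 1 \<in> F" if "x \<in> F" for x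
    using assms(1) that unfolding is_subfield_def by blast
  have "bij_betw (\<lambda>x. x + 1) F F"
    by (rule bij_betwI[where g = "\<lambda>x. x - 1"]) (auto simp: add diff)
  then have "(\<Sum>x\<in>F. x + 1) = (\<Sum>x\<in>F. x)"
    by (rule sum.reindex_bij_betw)
  then show ?thesis
    by (simp add: sum.distrib)
qed

text \<open>The group inverse is a definite description over the carrier, so it is enough that
  \<open>x\<close> and its field inverse lie in \<open>E\<close>. This form serves both subfields
  without 0 and \<open>K_pos S\<close>.\<close>

lemma m_inv_mult_grp:
  assumes "x \<in> E" "inverse x \<in> E" "x \<noteq> 0"
  shows "inv\<^bsub>mult_grp E\<^esub> x = inverse x"
  unfolding m_inv_def mult_grp_def
  using assms by (intro the_equality) (auto simp: field_simps)

lemma group_mult_grp: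
  assumes "is_subfield E"
  shows "group (mult_grp (E - {0}))"
proof (rule groupI)
  fix x assume "x \<in> carrier (mult_grp (E - {0}))"
  then show "\<exists>y\<in>carrier (mult_grp (E - {0})). y \<otimes>\<^bsub>mult_grp (E - {0})\<^esub> x = \<one>\<^bsub>mult_grp (E - {0})\<^esub>"
    using assms by (intro bexI[of _ "inverse x"]) (auto simp: mult_grp_def is_subfield_def)
qed (use assms in \<open>auto simp: mult_grp_def is_subfield_def\<close>)

lemma nat_pow_mult_grp: "x [^]\<^bsub>mult_grp E\<^esub> (n::nat) = x ^ n"
  by (induction n) (simp_all add: mult_grp_def nat_pow_def mult.commute)

lemma int_pow_mult_grp:
  assumes "is_subfield E" "x \<in> E" "x \<noteq> 0"
  shows "x [^]\<^bsub>mult_grp (E - {0})\<^esub> (m::int) = x powi m"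
proof -
  have E: "x ^ n \<in> E" "inverse (x ^ n) \<in> E" for n
    using is_subfield_power[OF assms(1,2)] assms(1) by (auto simp: is_subfield_def)
  have "inv\<^bsub>mult_grp (E - {0})\<^esub> (x ^ n) = inverse (x ^ n)" for n
    by (rule m_inv_mult_grp) (use E assms(3) in auto)
  then show ?thesis
    by (simp add: int_pow_def2 nat_pow_mult_grp power_int_def power_inverse)
qed

text \<open>
  Whether \<open>gal E F\<close> is closed under inverses is irrelevant here: powers are computed in the group of
  all bijections of \<open>E\<close>, and the inverse of an image is the image of the inverse.
\<close>

lemma hom_gal_int_pow:
  assumes "group M" "h \<in> hom M (gal E F)" "a \<in> carrier M"
  shows "h (a [^]\<^bsub>M\<^esub> (m::int)) = h a [^]\<^bsub>gal E F\<^esub> m"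
proof -
  interpret M: group M by fact
  interpret B: group "BijGroup E" by (rule group_BijGroup)
  have sub: "carrier (gal E F) \<subseteq> carrier (BijGroup E)"
    by (auto simp: gal_def BijGroup_def)
  have mult: "mult (gal E F) = mult (BijGroup E)" "one (gal E F) = one (BijGroup E)"
    by (simp_all add: gal_def)
  have "h \<in> hom M (BijGroup E)"
    using assms(2) sub mult unfolding hom_def by auto
  then interpret h: group_hom M "BijGroup E" h
    by unfold_locales
  have nat: "f [^]\<^bsub>gal E F\<^esub> (n::nat) = f [^]\<^bsub>BijGroup E\<^esub> n" for f n
    by (simp add: nat_pow_def mult)
  have inv: "inv\<^bsub>gal E F\<^esub> h b = inv\<^bsub>BijGroup E\<^esub> h b" if "b \<in> carrier M" for b
    unfolding m_inv_def[of "gal E F"] mult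
  proof (rule the_equality)
    have "h (inv\<^bsub>M\<^esub> b) \<in> carrier (gal E F)"
      using assms(2) that by (auto simp: hom_def simp del: h.hom_inv)
    then have "inv\<^bsub>BijGroup E\<^esub> h b \<in> carrier (gal E F)"
      using h.hom_inv[OF that] by simp
    then show "inv\<^bsub>BijGroup E\<^esub> h b \<in> carrier (gal E F) \<and>
        h b \<otimes>\<^bsub>BijGroup E\<^esub> inv\<^bsub>BijGroup E\<^esub> h b = \<one>\<^bsub>BijGroup E\<^esub> \<and>
        inv\<^bsub>BijGroup E\<^esub> h b \<otimes>\<^bsub>BijGroup E\<^esub> h b = \<one>\<^bsub>BijGroup E\<^esub>"
      using that by simp
  next
    fix g assume "g \<in> carrier (gal E F) \<and> h b \<otimes>\<^bsub>BijGroup E\<^esub> g = \<one>\<^bsub>BijGroup E\<^esub> \<and>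
        g \<otimes>\<^bsub>BijGroup E\<^esub> h b = \<one>\<^bsub>BijGroup E\<^esub>"
    then show "g = inv\<^bsub>BijGroup E\<^esub> h b"
      using B.inv_equality[of g "h b"] sub that by auto
  qed
  have pow: "h (a [^]\<^bsub>M\<^esub> n) = h a [^]\<^bsub>gal E F\<^esub> n" for n :: nat
    using h.hom_nat_pow[OF assms(3)] nat by simp
  show ?thesis
    using inv[of "a [^]\<^bsub>M\<^esub> (nat (- m))"] assms(3)
    by (simp add: int_pow_def2 pow[symmetric] h.hom_inv del: pow_nat)
qed

context ff_infinity
begin

section \<open>The ultrametric absolute value\<close>

lemma absval_nonneg: "0 \<le> absval S x"
  using absval_0 absval_pos[of x] by (cases "x = 0") auto

lemma absval_1: "absval S 1 = 1"
  using absval_mult[of 1 1] absval_pos[of 1] by simp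

lemma absval_minus: "absval S (- x) = absval S x"
proof -
  have "absval S (- 1) * absval S (- 1) = 1"
    using absval_mult[of "- 1" "- 1"] absval_1 by simp
  then have "absval S (- 1) = 1"
    using absval_nonneg[of "- 1"] by (auto simp: square_eq_1_iff)
  then show ?thesis
    using absval_mult[of "- 1" x] by simp
qed

lemma absval_diff_commute: "absval S (x - y) = absval S (y - x)"
  using absval_minus[of "x - y"] by simp

lemma absval_power: "absval S (x ^ n) = absval S x ^ n"
  by (induction n) (simp_all add: absval_1 absval_mult)

lemma absval_inverse: "absval S (inverse x) = inverse (absval S x)"
proof (cases "x = 0")
  case False
  then have "absval S x * absval S (inverse x) = 1"
    using absval_mult[of x "inverse x"] absval_1 by simp
  then show ?thesis by (metis inverse_unique)
qed (simp add: absval_0)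

lemma absval_powi: "absval S (x powi n) = absval S x powi n"
  by (simp add: power_int_def absval_power absval_inverse)

text \<open>The isosceles triangle principle: the ultrametric inequality is applied to
  \<open>x = (x - y) + y\<close> and to \<open>y = (y - x) + x\<close>.\<close>

lemma absval_eq_of_diff_less:
  assumes "absval S (x - y) < absval S y"
  shows "absval S x = absval S y"
  using absval_ultra[of "x - y" y] absval_ultra[of "y - x" x] absval_diff_commute[of x y] assms
  by simp

lemma absval_sum_le:
  assumes "\<And>i. i \<in> I \<Longrightarrow> absval S (f i) \<le> B" "0 \<le> B"
  shows "absval S (sum f I) \<le> B"
  using assms
proof (induction I rule: infinite_finite_induct)
  case (insert i I)
  then have "absval S (f i) \<le> B" "absval S (sum f I) \<le> B" by auto
  then show ?case
    using insert.hyps absval_ultra[of "f i" "sum f I"] by simp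
qed (simp_all add: absval_0)

text \<open>Up to sign an integer is a sum of ones. This bound makes a power series with integer
  coefficients converge on the open unit disc.\<close>

lemma absval_of_int_le: "absval S (of_int k) \<le> 1"
proof -
  have nat: "absval S (of_nat n) \<le> 1" for n
    using absval_sum_le[of "{..<n}" "\<lambda>_. 1" 1] absval_1 by simp
  show ?thesis
    using nat[of "nat \<bar>k\<bar>"] absval_minus[of "of_int k"] by (cases "0 \<le> k") auto
qed

section \<open>Continuity of the field operations\<close>

text \<open>The sort of \<open>'c\<close> does not relate metric and multiplication; only
  \<open>dist_absval\<close> does. Continuity therefore comes from expanding
  \<open>f x * g x - a * b\<close> in the differences \<open>f x - a\<close> and
  \<open>g x - b\<close>.\<close>

lemma tendsto_mult_absval:
  fixes f g :: "_ \<Rightarrow> 'c"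
  assumes "(f \<longlongrightarrow> a) A" "(g \<longlongrightarrow> b) A"
  shows "((\<lambda>x. f x * g x) \<longlongrightarrow> a * b) A"
proof -
  have lim: "((\<lambda>x. absval S (f x - a)) \<longlongrightarrow> 0) A" "((\<lambda>x. absval S (g x - b)) \<longlongrightarrow> 0) A"
    using assms by (simp_all add: tendsto_dist_iff[of f] tendsto_dist_iff[of g] dist_absval)
  have le: "absval S (f x * g x - a * b) \<le> absval S (f x - a) * absval S (g x - b) +
      absval S a * absval S (g x - b) + absval S (f x - a) * absval S b" for x
  proof -
    have "f x * g x - a * b = (f x - a) * (g x - b) + a * (g x - b) + (f x - a) * b"
      by (simp add: algebra_simps)
    moreover have "absval S (u + v + w) \<le> absval S u + absval S v + absval S w" for u v w
      using absval_ultra[of u v] absval_ultra[of "u + v" w] absval_nonneg[of u] absval_nonneg[of v]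
        absval_nonneg[of w] by linarith
    ultimately show ?thesis by (metis absval_mult)
  qed
  have "((\<lambda>x. absval S (f x - a) * absval S (g x - b) +
      absval S a * absval S (g x - b) + absval S (f x - a) * absval S b) \<longlongrightarrow> 0) A"
    using lim by (auto intro!: tendsto_eq_intros)
  then have "((\<lambda>x. absval S (f x * g x - a * b)) \<longlongrightarrow> 0) A"
    by (rule tendsto_sandwich[OF always_eventually always_eventually tendsto_const, rotated 2])
      (auto intro: le absval_nonneg)
  then show ?thesis
    by (simp add: tendsto_dist_iff[of "\<lambda>x. f x * g x"] dist_absval)
qed

lemma tendsto_diff_absval:
  fixes f g :: "_ \<Rightarrow> 'c"
  assumes "(f \<longlongrightarrow> a) A" "(g \<longlongrightarrow> b) A"
  shows "((\<lambda>x. f x - g x) \<longlongrightarrow> a - b) A"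
proof -
  have lim: "((\<lambda>x. absval S (f x - a)) \<longlongrightarrow> 0) A" "((\<lambda>x. absval S (g x - b)) \<longlongrightarrow> 0) A"
    using assms by (simp_all add: tendsto_dist_iff[of f] tendsto_dist_iff[of g] dist_absval)
  have le: "absval S (f x - g x - (a - b)) \<le> absval S (f x - a) + absval S (g x - b)" for x
    using absval_ultra[of "f x - a" "- (g x - b)"] absval_minus[of "g x - b"]
      absval_nonneg[of "f x - a"] absval_nonneg[of "g x - b"]
    by (simp add: algebra_simps)
  have "((\<lambda>x. absval S (f x - a) + absval S (g x - b)) \<longlongrightarrow> 0) A"
    using lim by (auto intro!: tendsto_eq_intros)
  then have "((\<lambda>x. absval S (f x - g x - (a - b))) \<longlongrightarrow> 0) A"
    by (rule tendsto_sandwich[OF always_eventually always_eventually tendsto_const, rotated 2])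
      (auto intro: le absval_nonneg)
  then show ?thesis
    by (simp add: tendsto_dist_iff[of "\<lambda>x. f x - g x"] dist_absval)
qed

text \<open>Close to \<open>a\<close> the isosceles principle gives \<open>f x\<close> the same
  absolute value as \<open>a\<close>. The distance of the inverses is then exactly that of
  \<open>f x\<close> and \<open>a\<close>, divided by the square of this value.\<close>

lemma tendsto_inverse_absval:
  fixes f :: "_ \<Rightarrow> 'c"
  assumes "(f \<longlongrightarrow> a) A" "a \<noteq> 0"
  shows "((\<lambda>x. inverse (f x)) \<longlongrightarrow> inverse a) A"
proof -
  have lim: "((\<lambda>x. absval S (f x - a)) \<longlongrightarrow> 0) A"
    using assms(1) by (simp add: tendsto_dist_iff[of f] dist_absval)
  then have "\<forall>\<^sub>F x in A. absval S (f x - a) < absval S a"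
    using absval_pos[OF assms(2)] by (rule order_tendstoD)
  then have ev: "\<forall>\<^sub>F x in A. absval S (f x - a) / (absval S a * absval S a) =
      absval S (inverse (f x) - inverse a)"
  proof eventually_elim
    case (elim x)
    then have eq: "absval S (f x) = absval S a" by (rule absval_eq_of_diff_less)
    then have "f x \<noteq> 0" using absval_pos[OF assms(2)] absval_0 by auto
    then have "inverse (f x) - inverse a = (a - f x) * inverse (f x) * inverse a"
      using assms(2) by (simp add: field_simps)
    then have "absval S (inverse (f x) - inverse a) =
        absval S (a - f x) * inverse (absval S (f x)) * inverse (absval S a)"
      by (simp only: absval_mult absval_inverse)
    then show ?case
      using eq absval_diff_commute[of a "f x"] by (simp add: divide_inverse)
  qed
  have "((\<lambda>x. absval S (f x - a) / (absval S a * absval S a)) \<longlongrightarrow> 0) A"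
    using lim by (rule tendsto_divide_zero)
  from Lim_transform_eventually[OF this ev] show ?thesis
    by (simp add: tendsto_dist_iff[of "\<lambda>x. inverse (f x)"] dist_absval)
qed

section \<open>The field at infinity and its characteristic\<close>

lemma is_subfield_fun_fld: "is_subfield (fun_fld S)"
  using function_field by (simp add: function_field_def)

text \<open>Elements of the closure are limits of sequences in the function field, and the field
  operations are continuous.\<close>

lemma is_subfield_K_inf: "is_subfield (K_inf S)"
proof -
  have K: "fun_fld S \<subseteq> K_inf S"
    by (simp add: K_inf_def closure_subset)
  have lim: "x \<in> K_inf S" if "\<And>n. f n \<in> fun_fld S" "f \<longlonglongrightarrow> x" for f x
    unfolding K_inf_def closure_sequential using that by blast
  have seq: "\<exists>f. (\<forall>n. f n \<in> fun_fld S) \<and> f \<longlonglongrightarrow> x" if "x \<in> K_inf S" for x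
    using that unfolding K_inf_def closure_sequential .
  have "x - y \<in> K_inf S \<and> x * y \<in> K_inf S" if xy: "x \<in> K_inf S" "y \<in> K_inf S" for x y
  proof -
    obtain f where f: "\<And>n. f n \<in> fun_fld S" "f \<longlonglongrightarrow> x"
      using seq[OF xy(1)] by blast
    obtain g where g: "\<And>n. g n \<in> fun_fld S" "g \<longlonglongrightarrow> y"
      using seq[OF xy(2)] by blast
    have "f n - g n \<in> fun_fld S" "f n * g n \<in> fun_fld S" for n
      using f(1) g(1) is_subfield_fun_fld unfolding is_subfield_def by blast+
    then show ?thesis
      using lim[OF _ tendsto_diff_absval[OF f(2) g(2)]] lim[OF _ tendsto_mult_absval[OF f(2) g(2)]]
      by blast
  qed
  moreover have "inverse x \<in> K_inf S" if x: "x \<in> K_inf S" for x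
  proof (cases "x = 0")
    case False
    obtain f where f: "\<And>n. f n \<in> fun_fld S" "f \<longlonglongrightarrow> x"
      using seq[OF x] by blast
    \<comment> \<open>Terms with \<open>f n = 0\<close> do no harm, since
      \<open>inverse 0 = 0\<close> lies in the function field.\<close>
    have "inverse (f n) \<in> fun_fld S" for n
      using f(1) is_subfield_fun_fld unfolding is_subfield_def by blast
    then show ?thesis
      using tendsto_inverse_absval[OF f(2) False] by (rule lim)
  qed (use x in simp)
  moreover have "0 \<in> K_inf S" "1 \<in> K_inf S"
    using K is_subfield_fun_fld by (auto simp: is_subfield_def)
  ultimately show ?thesis
    unfolding is_subfield_def by blast
qed

text \<open>The locale ties p to the field through the number of constants. That number is a power
  of p and vanishes in the field, so p vanishes too.\<close>

lemma of_nat_res_char: "of_nat (res_char S) = (0::'c)"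
proof -
  obtain r where "card (const_fld S) = res_char S ^ r"
    using card_const by blast
  moreover have "of_nat (card (const_fld S)) = (0::'c)"
    using function_field by (intro of_nat_card_subfield) (auto simp: function_field_def)
  ultimately show ?thesis by simp
qed

text \<open>This allows the residues modulo p in the series for \<open>padic_pow\<close> to be
  replaced by the binomial coefficients themselves.\<close>

lemma of_int_mod_res_char: "of_int (k mod int (res_char S)) = (of_int k :: 'c)"
proof -
  have "(of_int k :: 'c) = of_int (int (res_char S) * (k div int (res_char S)) + k mod int (res_char S))"
    by simp
  also have "\<dots> = of_int (k mod int (res_char S))"
    unfolding of_int_add of_int_mult of_int_of_nat_eq of_nat_res_char by simp
  finally show ?thesis by simp
qed

section \<open>Order and one-unit part of elements of \<open>K_pos\<close>\<close>

lemma unif_in_K_inf: "unif S \<in> K_inf S" and unif_nonzero: "unif S \<noteq> 0"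
  using unif by (simp_all add: uniformizer_def)

lemma absval_unif: "0 < absval S (unif S)" "absval S (unif S) < 1"
  using unif absval_pos by (simp_all add: uniformizer_def)

text \<open>Powers of a real number strictly between 0 and 1 strictly decrease. This is the
  uniqueness behind \<open>ord_inf\<close>.\<close>

lemma absval_unif_powi_inject:
  "absval S (unif S) powi m = absval S (unif S) powi n \<longleftrightarrow> m = n"
  using power_int_strict_decreasing[of m n "absval S (unif S)"]
    power_int_strict_decreasing[of n m "absval S (unif S)"] absval_unif
  by (cases m n rule: linorder_cases) auto

lemma absval_one_unit:
  assumes "w \<in> one_units S"
  shows "absval S w = 1"
  using assms absval_eq_of_diff_less[of w 1] absval_1 by (simp add: one_units_def)

lemma one_unit_nonzero:
  assumes "w \<in> one_units S"
  shows "w \<noteq> 0"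
  using absval_one_unit[OF assms] absval_0 by auto

lemma one_in_one_units: "1 \<in> one_units S"
  using is_subfield_K_inf by (simp add: one_units_def absval_0 is_subfield_def)

lemma one_units_mult:
  assumes "w \<in> one_units S" "w' \<in> one_units S"
  shows "w * w' \<in> one_units S"
proof -
  have "absval S (w * w' - 1) \<le> max (absval S (w * (w' - 1))) (absval S (w - 1))"
    using absval_ultra[of "w * (w' - 1)" "w - 1"] by (simp add: algebra_simps)
  also have "\<dots> < 1"
    using assms absval_one_unit[OF assms(1)] by (simp add: absval_mult one_units_def)
  finally show ?thesis
    using assms is_subfield_K_inf by (simp add: one_units_def is_subfield_def)
qed

lemma one_units_inverse:
  assumes "w \<in> one_units S"
  shows "inverse w \<in> one_units S"
proof -
  have "inverse w - 1 = (1 - w) * inverse w"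
    using one_unit_nonzero[OF assms] by (simp add: field_simps)
  then have "absval S (inverse w - 1) = absval S (w - 1)"
    using absval_one_unit[OF assms] absval_diff_commute[of w 1]
    by (simp add: absval_mult absval_inverse)
  then show ?thesis
    using assms is_subfield_K_inf by (simp add: one_units_def is_subfield_def)
qed

lemma K_posE:
  assumes "x \<in> K_pos S"
  obtains n w where "x = unif S powi n * w" "w \<in> one_units S"
  using assms by (auto simp: K_pos_def)

lemma K_posI: "w \<in> one_units S \<Longrightarrow> unif S powi n * w \<in> K_pos S"
  by (auto simp: K_pos_def)

lemma one_units_subset_K_pos: "one_units S \<subseteq> K_pos S"
  using K_posI[of _ 0] by auto

lemma K_pos_subset_K_inf: "K_pos S \<subseteq> K_inf S - {0}"
proof
  fix x assume "x \<in> K_pos S"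
  then obtain n w where x: "x = unif S powi n * w" "w \<in> one_units S" by (rule K_posE)
  then have "unif S powi n \<in> K_inf S" "w \<in> K_inf S"
    using is_subfield_powi[OF is_subfield_K_inf unif_in_K_inf] by (auto simp: one_units_def)
  then show "x \<in> K_inf S - {0}"
    using x is_subfield_K_inf unif_nonzero one_unit_nonzero by (auto simp: is_subfield_def)
qed

lemma ord_inf_eq:
  assumes "absval S x = absval S (unif S) powi n"
  shows "ord_inf S x = n"
  unfolding ord_inf_def using assms by (auto simp: absval_unif_powi_inject)

lemma ord_inf_unif_mult:
  assumes "w \<in> one_units S"
  shows "ord_inf S (unif S powi n * w) = n"
  using absval_one_unit[OF assms] by (intro ord_inf_eq) (simp add: absval_mult absval_powi)

lemma ang_unif_mult:
  assumes "w \<in> one_units S"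
  shows "ang S (unif S powi n * w) = w"
  using unif_nonzero by (simp add: ang_def ord_inf_unif_mult[OF assms])

lemma ord_inf_image_K_pos: "ord_inf S ` K_pos S = UNIV"
proof -
  have "n \<in> ord_inf S ` K_pos S" for n
    using ord_inf_unif_mult[OF one_in_one_units, of n] K_posI[OF one_in_one_units, of n]
    by (metis imageI)
  then show ?thesis by auto
qed

lemma ang_in_one_units: "x \<in> K_pos S \<Longrightarrow> ang S x \<in> one_units S"
  by (metis K_posE ang_unif_mult)

lemma ang_image_K_pos: "ang S ` K_pos S = one_units S"
proof -
  have "w \<in> ang S ` K_pos S" if "w \<in> one_units S" for w
    using ang_unif_mult[OF that, of 0] one_units_subset_K_pos that by force
  then show ?thesis using ang_in_one_units by blast
qed

text \<open>Scaling by a one-unit moves only the one-unit part, and scaling by a power of the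
  uniformizer moves only the order. This separates the two restricted actions.\<close>

lemma one_units_mult_K_pos:
  assumes "\<gamma> \<in> one_units S" "x \<in> K_pos S"
  shows "ord_inf S (\<gamma> * x) = ord_inf S x" "ang S (\<gamma> * x) = \<gamma> * ang S x"
proof -
  obtain n w where x: "x = unif S powi n * w" "w \<in> one_units S"
    using assms(2) by (rule K_posE)
  have eq: "\<gamma> * x = unif S powi n * (\<gamma> * w)" using x(1) by (simp add: mult_ac)
  show "ord_inf S (\<gamma> * x) = ord_inf S x" "ang S (\<gamma> * x) = \<gamma> * ang S x"
    unfolding eq unfolding x(1)
    using x(2) one_units_mult[OF assms(1) x(2)] by (simp_all add: ord_inf_unif_mult ang_unif_mult)
qed

lemma unif_powi_mult_K_pos:
  assumes "x \<in> K_pos S"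
  shows "ord_inf S (unif S powi m * x) = m + ord_inf S x" "ang S (unif S powi m * x) = ang S x"
proof -
  obtain n w where x: "x = unif S powi n * w" "w \<in> one_units S"
    using assms by (rule K_posE)
  have eq: "unif S powi m * x = unif S powi (m + n) * w"
    using x(1) unif_nonzero by (simp add: power_int_add)
  show "ord_inf S (unif S powi m * x) = m + ord_inf S x" "ang S (unif S powi m * x) = ang S x"
    unfolding eq unfolding x(1) using x(2) by (simp_all add: ord_inf_unif_mult ang_unif_mult)
qed

section \<open>Exponentiation of one-units by p-adic integers\<close>

text \<open>All terms from index \<open>m\<close> on are bounded by \<open>absval S z ^ m\<close>,
  and in the ultrametric setting so are their finite sums. Completeness then yields
  convergence.\<close>

lemma summable_binomial_series:
  assumes "absval S z < 1"
  shows "summable (\<lambda>j. of_int (c j) * z ^ j)"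
proof -
  let ?f = "\<lambda>j. of_int (c j) * z ^ j"
  let ?s = "\<lambda>n. sum ?f {..<n}"
  have le: "absval S (?s n - ?s m) \<le> absval S z ^ m" if "m \<le> n" for m n
  proof -
    have "absval S (?f j) \<le> absval S z ^ m" if "j \<in> {m..<n}" for j
    proof -
      have "absval S (?f j) \<le> 1 * absval S z ^ j"
        unfolding absval_mult absval_power
        by (intro mult_right_mono absval_of_int_le zero_le_power absval_nonneg)
      also have "\<dots> \<le> absval S z ^ m"
        using that assms absval_nonneg[of z] by (simp add: power_decreasing)
      finally show ?thesis .
    qed
    then have "absval S (sum ?f {m..<n}) \<le> absval S z ^ m"
      by (intro absval_sum_le) (simp_all add: absval_nonneg)
    then show ?thesis
      using sum_diff_nat_ivl[of 0 m n ?f] that by (simp add: atLeast0LessThan)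
  qed
  have "Cauchy ?s"
  proof (rule metric_CauchyI)
    fix e :: real assume "0 < e"
    then obtain M where M: "absval S z ^ M < e"
      using real_arch_pow_inv[of e "absval S z"] assms by auto
    have dist_M: "absval S (?s n - ?s M) < e" if "M \<le> n" for n
      using le[OF that] M by linarith
    \<comment> \<open>Passing through \<open>?s M\<close> costs only a maximum, so the bound
      \<open>e\<close> need not be halved.\<close>
    have "dist (?s m) (?s n) < e" if "M \<le> m" "M \<le> n" for m n
      using absval_ultra[of "?s m - ?s M" "?s M - ?s n"] dist_M[OF that(1)] dist_M[OF that(2)]
        absval_diff_commute[of "?s n" "?s M"] by (simp add: dist_absval)
    then show "\<exists>M. \<forall>m\<ge>M. \<forall>n\<ge>M. dist (?s m) (?s n) < e" by blast
  qed
  then have "convergent ?s" by (rule Cauchy_convergent)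
  then show ?thesis by (simp add: summable_iff_convergent)
qed

lemma power_tendsto_padic_pow:
  assumes "y \<in> padics (res_char S)" "absval S (w - 1) < 1"
  shows "(\<lambda>n. w ^ nat (y n)) \<longlonglongrightarrow> padic_pow (res_char S) w y"
proof -
  let ?p = "res_char S"
  let ?f = "\<lambda>j. of_int (padic_choose ?p y j 1) * (w - 1) ^ j"
  have "(\<lambda>n. sum ?f {..<n}) \<longlonglongrightarrow> padic_pow ?p w y"
    unfolding padic_pow_def by (rule summable_LIMSEQ[OF summable_binomial_series[OF assms(2)]])
  \<comment> \<open>The partial sums are read along the indices \<open>p ^ n\<close>, where they
    become honest powers of \<open>w\<close>.\<close>
  moreover have "strict_mono (\<lambda>n. ?p ^ n)"
    using prime_gt_1_nat[OF prime_char] by (simp add: strict_mono_def power_strict_increasing)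
  ultimately have lim: "(\<lambda>n. sum ?f {..<?p ^ n}) \<longlonglongrightarrow> padic_pow ?p w y"
    using LIMSEQ_subseq_LIMSEQ[of "\<lambda>n. sum ?f {..<n}" _ "\<lambda>n. ?p ^ n"] by (simp add: o_def)
  have "sum ?f {..<?p ^ n} = w ^ nat (y n)" for n
  proof -
    have "nat (y n) < ?p ^ n"
      using assms(1) by (auto simp: padics_def nat_less_iff)
    moreover have "?f j = of_nat (nat (y n) choose j) * (w - 1) ^ j" if "j < ?p ^ n" for j
      using padic_choose_mod_p[OF prime_char assms(1) that] by (simp add: of_int_mod_res_char)
    \<comment> \<open>The terms with \<open>y n < j < p ^ n\<close> vanish because their binomial
      coefficient is 0.\<close>
    ultimately have "sum ?f {..<?p ^ n} = (\<Sum>j\<le>nat (y n). of_nat (nat (y n) choose j) * (w - 1) ^ j)"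
      by (intro sum.mono_neutral_cong_right) (auto, metis binomial_eq_0 leI of_nat_0)
    \<comment> \<open>The binomial theorem for \<open>(w - 1) + 1\<close>.\<close>
    also have "\<dots> = w ^ nat (y n)"
      using binomial_ring[of "w - 1" 1 "nat (y n)"] by simp
    finally show ?thesis .
  qed
  with lim show ?thesis by simp
qed

text \<open>The rule holds for natural exponents and passes to the limit, which avoids multiplying
  binomial series.\<close>

lemma padic_pow_mult:
  assumes "y \<in> padics (res_char S)" "w \<in> one_units S" "w' \<in> one_units S"
  shows "padic_pow (res_char S) (w * w') y = padic_pow (res_char S) w y * padic_pow (res_char S) w' y"
proof -
  have lim: "(\<lambda>n. u ^ nat (y n)) \<longlonglongrightarrow> padic_pow (res_char S) u y" if "u \<in> one_units S" for u
    using that assms(1) by (intro power_tendsto_padic_pow) (auto simp: one_units_def)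
  have "(\<lambda>n. (w * w') ^ nat (y n)) \<longlonglongrightarrow>
      padic_pow (res_char S) w y * padic_pow (res_char S) w' y"
    using tendsto_mult_absval[OF lim[OF assms(2)] lim[OF assms(3)]] by (simp add: power_mult_distrib)
  with lim[OF one_units_mult[OF assms(2,3)]] show ?thesis
    by (rule LIMSEQ_unique)
qed

section \<open>Scaling actions as changes of the integrand\<close>

lemma expo_one_unit_mult:
  assumes "\<gamma> \<in> one_units S" "x \<in> K_pos S" "snd s \<in> padics (res_char S)"
  shows "expo S (\<gamma> * x) s = padic_pow (res_char S) \<gamma> (snd s) * expo S x s"
  using padic_pow_mult[OF assms(3,1) ang_in_one_units[OF assms(2)]]
  by (simp add: expo_def deg_def one_units_mult_K_pos[OF assms(1,2)])

lemma expo_unif_powi_mult: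
  assumes "x \<in> K_pos S" "fst s \<noteq> 0"
  shows "expo S (unif S powi m * x) s = fst s powi (- int (deg_inf S) * m) * expo S x s"
  \<comment> \<open>Splitting an integer exponent into a sum requires a nonzero base, as the
    summands may have opposite signs.\<close>
  using assms(2)
  by (simp add: expo_def deg_def unif_powi_mult_K_pos[OF assms(1)] power_int_add[symmetric] ring_distribs)

text \<open>Equality of the operators is reduced to equality of the integrands. The function
  \<open>c\<close> is both the factor by which \<open>T\<close> multiplies a coefficient and the
  factor by which \<gamma> changes \<open>expo\<close>.\<close>

lemma correspondsI:
  assumes "\<And>s. s \<in> H \<Longrightarrow> snd s \<in> padics (res_char S)"
    and "\<And>f s. T f [s] = (\<lambda>P. c (S_sum (res_char S) [s]) * f [s] P)"
    and "\<And>x s. x \<in> K_pos S \<Longrightarrow> s \<in> H \<Longrightarrow> expo S (\<gamma> * x) s = c s * expo S x s"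
  shows "corresponds S scl H \<mu> U T \<gamma>"
  unfolding corresponds_def
proof (intro ballI allI impI)
  fix l x L L' assume x: "x \<in> K_pos S"
  \<comment> \<open>The equation is needed for every \<open>s\<close>, so that the integrands
    coincide as functions; outside \<open>H\<close> both sides are 0 by the default value in
    \<open>dual_gen\<close>.\<close>
  have "T (dual_gen H l) [s] (L, L') * expo S x s = dual_gen H l [s] (L, L') * expo S (\<gamma> * x) s" for s
  proof (cases "s \<in> H")
    case True
    \<comment> \<open>Adding the neutral element reduces each entry modulo \<open>p ^ n\<close>, so
      it returns \<open>s\<close> because its second component is a p-adic integer.\<close>
    then have "S_sum (res_char S) [s] = s"
      using assms(1) by (simp add: S_sum_def S_add_def S_zero_def padic_add_zero)
    then show ?thesis
      using assms(3)[OF x True] by (simp add: assms(2) mult_ac)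
  qed (simp add: assms(2) dual_gen_def)
  then show "X_map S scl H \<mu> U (T (dual_gen H l)) (x, L) (x, L') =
      X_map S scl H \<mu> U (dual_gen H l) (rescale \<gamma> (x, L)) (rescale \<gamma> (x, L'))"
    by (simp add: X_map_def rescale_def)
qed

section \<open>Inertia and Frobenius under the Artin map\<close>

text \<open>Inertia is the image of the units. By injectivity an element of \<open>K_pos S\<close>
  mapped into it is itself a unit; its order is then 0, so it equals its own one-unit part.\<close>

lemma K_pos_inertia_eq_one_units:
  assumes "inj_on \<Theta> (K_inf S - {0})"
    and "\<Theta> \<in> iso (mult_grp (units_inf S)) (gal (K_ab S) (K_un S))"
  shows "{\<gamma> \<in> K_pos S. \<Theta> \<gamma> \<in> inertia S} = one_units S"
proof -
  have inertia: "inertia S = \<Theta> ` units_inf S"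
    using assms(2) by (auto simp: inertia_def iso_def bij_betw_def mult_grp_def)
  have units: "units_inf S \<subseteq> K_inf S - {0}"
    using absval_0 by (auto simp: units_inf_def)
  have "\<gamma> \<in> one_units S" if \<gamma>: "\<gamma> \<in> K_pos S" "\<Theta> \<gamma> \<in> inertia S" for \<gamma>
  proof -
    obtain u where "u \<in> units_inf S" "\<Theta> \<gamma> = \<Theta> u"
      using \<gamma>(2) inertia by blast
    then have "\<gamma> \<in> units_inf S"
      using inj_onD[OF assms(1)] \<gamma>(1) K_pos_subset_K_inf units by (metis subsetD)
    then have "absval S \<gamma> = absval S (unif S) powi 0"
      by (simp add: units_inf_def)
    then have "ord_inf S \<gamma> = 0" by (rule ord_inf_eq)
    then have "ang S \<gamma> = \<gamma>" by (simp add: ang_def)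
    then show ?thesis using ang_in_one_units[OF \<gamma>(1)] by simp
  qed
  moreover have "\<Theta> w \<in> inertia S" if "w \<in> one_units S" for w
    using that absval_one_unit[OF that] by (auto simp: inertia units_inf_def one_units_def)
  ultimately show ?thesis using one_units_subset_K_pos by blast
qed

lemma subgroup_one_units: "subgroup (one_units S) (mult_grp (K_pos S))"
proof (rule subgroup.intro)
  fix w assume w: "w \<in> one_units S"
  then have "inv\<^bsub>mult_grp (K_pos S)\<^esub> w = inverse w"
    using one_units_subset_K_pos one_units_inverse[OF w] one_unit_nonzero[OF w]
    by (intro m_inv_mult_grp) auto
  then show "inv\<^bsub>mult_grp (K_pos S)\<^esub> w \<in> one_units S"
    using one_units_inverse[OF w] by simp
qed (use one_units_subset_K_pos one_units_mult one_in_one_units in \<open>auto simp: mult_grp_def\<close>)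

text \<open>A homomorphism on the group of nonzero elements of \<open>K_inf S\<close> respects
  integer powers, and powers in that group are field powers.\<close>

lemma artin_unif_powi:
  assumes "local_artin S \<Theta>"
  shows "\<Theta> (unif S powi m) = \<Theta> (unif S) [^]\<^bsub>gal (K_ab S) (K_inf S)\<^esub> m"
proof -
  have "\<Theta> \<in> hom (mult_grp (K_inf S - {0})) (gal (K_ab S) (K_inf S))"
    using assms by (simp add: local_artin_def)
  from hom_gal_int_pow[OF group_mult_grp[OF is_subfield_K_inf] this, of "unif S" m] show ?thesis
    using unif_in_K_inf unif_nonzero
    by (simp add: int_pow_mult_grp[OF is_subfield_K_inf]) (simp add: mult_grp_def)
qed

end

section \<open>The two restricted scaling actions\<close>

theorem proposition5p8:
  fixes S :: "('c::{field,complete_space}) ff_infinity"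
    and \<Theta> :: "'c \<Rightarrow> 'c \<Rightarrow> 'c"
    and G :: "'c set" and H :: "'c expt set" and \<mu> :: "'c expt set \<Rightarrow> 'c"
    and scl :: "'c \<Rightarrow> 'b::{ab_group_add,complete_space} \<Rightarrow> 'b" and nrm :: "'b \<Rightarrow> real"
    and \<pi> :: "'c coeff \<Rightarrow> 'b \<Rightarrow> 'b" and U :: "'c expt \<Rightarrow> 'b \<Rightarrow> 'b"
  assumes "ff_infinity S"
    and "local_artin S \<Theta>"
    and "inj_on \<Theta> (K_inf S - {0})"
    and "\<Theta> \<in> iso (mult_grp (units_inf S)) (gal (K_ab S) (K_un S))"
    and "compact_td_subgroup G"
    and "H = G \<times> padics (res_char S)"
    and "na_measure S H \<mu>"
    and "na_banach S scl nrm"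
    and "implements_time_ev S scl nrm H \<pi> U"
  defines "U1 \<equiv> {\<gamma> \<in> K_pos S. \<Theta> \<gamma> \<in> inertia S}"
  shows
    "U1 = one_units S \<and> subgroup U1 (mult_grp (K_pos S)) \<and> ang S ` K_pos S = U1 \<and>
     (\<forall>x\<in>K_pos S. \<forall>x'\<in>K_pos S. ang S x = ang S x' \<longrightarrow>
        (\<forall>f\<in>dual_system S H. theta_Zp S x f = theta_Zp S x' f)) \<and>
     (\<forall>x\<in>K_pos S. corresponds S scl H \<mu> U (theta_Zp S x) (ang S x)) \<and>
     ord_inf S ` K_pos S = UNIV \<and>
     (\<forall>x\<in>K_pos S. \<forall>x'\<in>K_pos S. ord_inf S x = ord_inf S x' \<longrightarrow>
        (\<forall>f\<in>dual_system S H. theta_G S x f = theta_G S x' f)) \<and>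
     (\<forall>x\<in>K_pos S. corresponds S scl H \<mu> U (theta_G S x) (unif S powi ord_inf S x)) \<and>
     frobenius_lift S (\<Theta> (unif S)) \<and>
     (\<forall>m::int. \<Theta> (unif S powi m) = \<Theta> (unif S) [^]\<^bsub>gal (K_ab S) (K_inf S)\<^esub> m)"
proof -
  interpret ff_infinity S by fact
  \<comment> \<open>\<open>G\<close> lies in the multiplicative group, so the first component of an
    exponent in \<open>H\<close> is never 0.\<close>
  have H: "fst s \<noteq> 0" "snd s \<in> padics (res_char S)" if "s \<in> H" for s
    using that subgroup.subset[of G "mult_grp (UNIV - {0})"] \<open>compact_td_subgroup G\<close> \<open>H = _\<close>
    by (auto simp: compact_td_subgroup_def mult_grp_def)
  have U1: "U1 = one_units S"
    unfolding U1_def using assms(3,4) by (rule K_pos_inertia_eq_one_units)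
  \<comment> \<open>Here \<gamma> is the one-unit \<open>ang S x\<close>, and the factor is its
    p-adic power.\<close>
  have Zp: "corresponds S scl H \<mu> U (theta_Zp S x) (ang S x)" if "x \<in> K_pos S" for x
    by (rule correspondsI[where c = "\<lambda>s. padic_pow (res_char S) (ang S x) (snd s)"])
      (use that in \<open>auto simp: theta_Zp_def expo_one_unit_mult ang_in_one_units H\<close>)
  \<comment> \<open>With \<open>m = ord_inf S x\<close>, the factor
    \<open>fst s powi (deg S x)\<close> is exactly what multiplication by
    \<open>unif S powi m\<close> contributes to \<open>expo\<close>.\<close>
  have G: "corresponds S scl H \<mu> U (theta_G S x) (unif S powi ord_inf S x)" for x
    by (rule correspondsI[where c = "\<lambda>s. fst s powi (deg S x)"])
      (auto simp: theta_G_def expo_unif_powi_mult H deg_def)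
  have "frobenius_lift S (\<Theta> (unif S))"
    using assms(2) unif by (simp add: local_artin_def)
  \<comment> \<open>The independence claims follow since \<open>theta_Zp\<close> involves
    \<open>x\<close> only through \<open>ang S x\<close>, and \<open>theta_G\<close> only through
    \<open>deg S x\<close>, a multiple of \<open>ord_inf S x\<close>.\<close>
  then show ?thesis
    using U1 subgroup_one_units ang_image_K_pos Zp ord_inf_image_K_pos G
      artin_unif_powi[OF assms(2)]
    by (simp add: theta_Zp_def theta_G_def deg_def)
qed

end
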